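(* Let $Q=\mathbb{R}^n$. Assume that $f$ is $L_f$-smooth and strongly convex with parameter $\mu\neq 0$ (i.e. $\mu>0$), and that the inexact gradient satisfies $\|\widetilde\nabla f(x)-\nabla f(x)\|_2\le\alpha\|\nabla f(x)\|_2$ for all $x\in\mathbb{R}^n$, where $\alpha\in[0,1)$ satisfies $$\alpha\le\frac17\,\frac{\mu_2}{L},\qquad \mu_2=\frac{\mu}{2},\quad L=2L_f.$$ Let $R$ be such that $\|x_{start}-x^*\|_2\le R$. Then for all $k\ge 1$ the sequence $\{y_k\}$ generated by Algorithm STM2 (described in the context) satisfies $$f(y_k)-f(x^* )\le\left(\frac{5LR^2}{4}+\frac{15}{196}\sqrt{\frac{2L}{\mu}}\,\bigl[f(y_0)-f(x^* )\bigr]\right)\exp\left(-\frac{k}{4}\sqrt{\frac{\mu}{2L}}\right).$$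
   Context: $x^*$ is the minimizer of $f$ on $\mathbb{R}^n$. $f$ is $L_f$-smooth: $\|\nabla f(x)-\nabla f(y)\|_2\le L_f\|x-y\|_2$ for all $x,y$; strongly convex with parameter $\mu$: $f(x)+\langle\nabla f(x),y-x\rangle+\frac{\mu}{2}\|x-y\|_2^2\le f(y)$ for all $x,y$. Algorithm STM2$(L,\mu_2,x_{start})$ with $Q=\mathbb{R}^n$: set $y_0=u_0=x_0=x_{start}$, $A_0=\alpha_0=1/L$. For $k=1,2,\dots$: let $\alpha_k=\frac{1+\mu_2A_{k-1}}{2L}+\sqrt{\frac{(1+\mu_2A_{k-1})^2}{4L^2}+\frac{A_{k-1}(1+\mu_2A_{k-1})}{L}}$ (the positive root of $(1+\mu_2A_{k-1})(A_{k-1}+\alpha_k)=L\alpha_k^2$), $A_k=A_{k-1}+\alpha_k$, $y_k=\frac{A_{k-1}x_{k-1}+\alpha_ku_{k-1}}{A_k}$, $\phi_k(x)=\alpha_k\langle\widetilde\nabla f(y_k),x-y_k\rangle+\frac{1+\mu_2A_{k-1}}{2}\|u_{k-1}-x\|_2^2+\frac{\mu_2\alpha_k}{2}\|y_k-x\|_2^2$, $u_k=\arg\min_{u\in\mathbb{R}^n}\phi_k(u)$, $x_k=\frac{A_{k-1}x_{k-1}+\alpha_ku_k}{A_k}$. (The step sizes $\alpha_k$ are unrelated to the noise level $\alpha$.) *)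

theory Defs
  imports "HOL-Analysis.Analysis"
begin

text \<open>The gradient is carried as an explicit function \<open>grad\<close>; it is determined by \<open>f\<close>
  through the condition on \<open>GDERIV\<close>.\<close>

definition smooth_with :: "real \<Rightarrow> ('a::real_inner \<Rightarrow> real) \<Rightarrow> ('a \<Rightarrow> 'a) \<Rightarrow> bool" where
  "smooth_with L f grad \<longleftrightarrow>
     (\<forall>x. GDERIV f x :> grad x) \<and>
     (\<forall>x y. norm (grad x - grad y) \<le> L * norm (x - y))"

definition strongly_convex_with :: "real \<Rightarrow> ('a::real_inner \<Rightarrow> real) \<Rightarrow> ('a \<Rightarrow> 'a) \<Rightarrow> bool" where
  "strongly_convex_with \<mu> f grad \<longleftrightarrow>
     (\<forall>x. GDERIV f x :> grad x) \<and>
     (\<forall>x y. f x + grad x \<bullet> (y - x) + \<mu> / 2 * (norm (x - y))\<^sup>2 \<le> f y)"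

definition stm2_stepsize :: "real \<Rightarrow> real \<Rightarrow> real \<Rightarrow> real" where
  "stm2_stepsize L \<mu>2 A =
     (1 + \<mu>2 * A) / (2 * L)
       + sqrt ((1 + \<mu>2 * A)\<^sup>2 / (4 * L\<^sup>2) + A * (1 + \<mu>2 * A) / L)"

text \<open>Here \<open>A\<close> and \<open>u\<close> are the values from the previous iteration, \<open>a\<close> is the current step
  size, \<open>y\<close> the current query point and \<open>g\<close> the inexact gradient at \<open>y\<close>.\<close>

definition stm2_phi ::
  "real \<Rightarrow> real \<Rightarrow> real \<Rightarrow> 'a::real_inner \<Rightarrow> 'a \<Rightarrow> 'a \<Rightarrow> 'a \<Rightarrow> real" where
  "stm2_phi \<mu>2 A a u y g x =
     a * (g \<bullet> (x - y))
       + (1 + \<mu>2 * A) / 2 * (norm (u - x))\<^sup>2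
       + \<mu>2 * a / 2 * (norm (y - x))\<^sup>2"

text \<open>The sequences form a run of the method on the whole space, started at \<open>x_start\<close>, with
  inexact gradient oracle \<open>G\<close>. The step sizes are called \<open>a\<close>, since \<open>\<alpha>\<close> denotes the noise
  level of the oracle.\<close>

definition stm2_run ::
  "real \<Rightarrow> real \<Rightarrow> 'a::real_inner \<Rightarrow> ('a \<Rightarrow> 'a) \<Rightarrow>
     (nat \<Rightarrow> real) \<Rightarrow> (nat \<Rightarrow> real) \<Rightarrow> (nat \<Rightarrow> 'a) \<Rightarrow> (nat \<Rightarrow> 'a) \<Rightarrow> (nat \<Rightarrow> 'a) \<Rightarrow> bool" where
  "stm2_run L \<mu>2 x_start G a A x y u \<longleftrightarrow>
     y 0 = x_start \<and> u 0 = x_start \<and> x 0 = x_start \<and>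
     a 0 = 1 / L \<and> A 0 = 1 / L \<and>
     (\<forall>k\<ge>1.
        a k = stm2_stepsize L \<mu>2 (A (k - 1)) \<and>
        A k = A (k - 1) + a k \<and>
        y k = (A (k - 1) *\<^sub>R x (k - 1) + a k *\<^sub>R u (k - 1)) /\<^sub>R A k \<and>
        is_arg_min (stm2_phi \<mu>2 (A (k - 1)) (a k) (u (k - 1)) (y k) (G (y k)))
          (\<lambda>_. True) (u k) \<and>
        x k = (A (k - 1) *\<^sub>R x (k - 1) + a k *\<^sub>R u k) /\<^sub>R A k)"

end

theory Submission
  imports Defs
begin

text \<open>With \<open>P\<^sub>k = A\<^sub>k (f (x\<^sub>k) - f (x\<^sup>*)) + (1 + \<mu>\<^sub>2 A\<^sub>k) / 2 \<cdot> |u\<^sub>k - x\<^sup>*|\<^sup>2\<close> as potential, one step with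
  gradient error \<open>e\<close> gives \<open>P\<^sub>k \<le> P\<^sub>k\<^sub>-\<^sub>1 + A\<^sub>k (1 / L + 1 / \<mu>) |e|\<^sup>2\<close>. The query point \<open>y\<^sub>k\<close> lies between
  \<open>x\<^sub>k\<^sub>-\<^sub>1\<close> and \<open>u\<^sub>k\<^sub>-\<^sub>1\<close>, so convexity bounds \<open>f (y\<^sub>k) - f (x\<^sup>*)\<close> by
  \<open>P\<^sub>k\<^sub>-\<^sub>1 max (1 / A\<^sub>k) (1 / (2 a\<^sub>k))\<close>, and \<open>|e|\<^sup>2 \<le> \<alpha>\<^sup>2 L (f (y\<^sub>k) - f (x\<^sup>*))\<close>. For
  \<open>t = sqrt (\<mu>\<^sub>2 / L)\<close> and \<open>\<alpha> \<le> t\<^sup>2 / 7\<close> the potential hence grows at most by the factor \<open>1 + t / 80\<close>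
  per step, while \<open>A\<^sub>k\<close> and \<open>L a\<^sub>k\<^sup>2\<close> grow at least like \<open>(1 + t)\<^sup>k / L\<close>, which leaves room for the
  rate \<open>t / 4\<close>.\<close>

section \<open>Quadratic bounds for smooth functions\<close>

text \<open>Trades a gradient error paired with a displacement for its square, with \<open>c\<close>
  set to the curvature that can be spared.\<close>

lemma young_inner:
  fixes v w :: "'a::real_inner"
  assumes "c > 0"
  shows "v \<bullet> w \<le> (norm v)\<^sup>2 / (4 * c) + c * (norm w)\<^sup>2"
proof -
  have "0 \<le> (norm v / (2 * sqrt c) - sqrt c * norm w)\<^sup>2"
    by simp
  also have "\<dots> = (norm v)\<^sup>2 / (4 * c) + c * (norm w)\<^sup>2 - norm v * norm w"
    using assms by (simp add: power2_diff power_divide power_mult_distrib)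
  finally show ?thesis
    using norm_cauchy_schwarz[of v w] by linarith
qed

text \<open>Up to a constant, \<open>h\<close> is \<open>f\<close> minus its quadratic model along
  the segment from \<open>x\<close> to \<open>y\<close>; Cauchy-Schwarz and the Lipschitz bound make
  \<open>h\<close> nonincreasing on [0, 1].\<close>

lemma smooth_with_descent:
  assumes "smooth_with L f grad"
  shows "f y \<le> f x + grad x \<bullet> (y - x) + L / 2 * (norm (y - x))\<^sup>2"
proof -
  define d where "d = y - x"
  define h where "h s = f (x + s *\<^sub>R d) - s * (grad x \<bullet> d) - L / 2 * s\<^sup>2 * (norm d)\<^sup>2" for s
  have grad: "(f has_derivative (\<lambda>v. v \<bullet> grad z)) (at z)"
    and lip: "norm (grad z - grad w) \<le> L * norm (z - w)" for z w
    using assms by (auto simp: smooth_with_def gderiv_def)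
  have h': "(h has_real_derivative
      (d \<bullet> grad (x + s *\<^sub>R d) - grad x \<bullet> d - L * s * (norm d)\<^sup>2)) (at s)" for s
  proof -
    have "((\<lambda>s. f (x + s *\<^sub>R d)) has_derivative (\<lambda>r. (r *\<^sub>R d) \<bullet> grad (x + s *\<^sub>R d))) (at s)"
      by (rule has_derivative_compose[OF _ grad]) (auto intro!: derivative_eq_intros)
    hence "((\<lambda>s. f (x + s *\<^sub>R d)) has_real_derivative (d \<bullet> grad (x + s *\<^sub>R d))) (at s)"
      by (simp add: has_field_derivative_def mult_commute_abs)
    thus ?thesis
      unfolding h_def by (auto intro!: derivative_eq_intros)
  qed
  have "h 1 \<le> h 0"
  proof (rule DERIV_nonpos_imp_nonincreasing[where f = h])
    fix s :: real assume s: "0 \<le> s" "s \<le> 1"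
    have "d \<bullet> grad (x + s *\<^sub>R d) - grad x \<bullet> d = (grad (x + s *\<^sub>R d) - grad x) \<bullet> d"
      by (simp add: inner_diff_right inner_commute)
    also have "\<dots> \<le> norm (grad (x + s *\<^sub>R d) - grad x) * norm d"
      by (rule norm_cauchy_schwarz)
    also have "\<dots> \<le> (L * norm ((x + s *\<^sub>R d) - x)) * norm d"
      by (intro mult_right_mono lip) auto
    also have "\<dots> = L * s * (norm d)\<^sup>2"
      using s by (simp add: power2_eq_square)
    finally show "\<exists>D. (h has_real_derivative D) (at s) \<and> D \<le> 0"
      using h'[of s] by (metis diff_le_0_iff_le)
  qed simp
  thus ?thesis
    by (simp add: h_def d_def)
qed

text \<open>A gradient step of length \<open>1 / L\<close> lowers \<open>f\<close> by at least |grad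
  x|^2 / (2 L), yet cannot pass below \<open>m\<close>.\<close>

lemma smooth_with_norm_grad_le:
  assumes smooth: "smooth_with L f grad" and "L > 0" and lower: "\<And>z. m \<le> f z"
  shows "(norm (grad x))\<^sup>2 \<le> 2 * L * (f x - m)"
proof -
  have "m \<le> f (x - (1 / L) *\<^sub>R grad x)"
    by (rule lower)
  also have "\<dots> \<le> f x - (norm (grad x))\<^sup>2 / L + L / 2 * ((norm (grad x))\<^sup>2 / L\<^sup>2)"
    using smooth_with_descent[OF smooth, of "x - (1 / L) *\<^sub>R grad x" x] \<open>L > 0\<close>
    by (simp add: power_divide power2_norm_eq_inner)
  also have "\<dots> = f x - (norm (grad x))\<^sup>2 / (2 * L)"
    using \<open>L > 0\<close> by (simp add: field_simps power2_eq_square)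
  finally show ?thesis
    using \<open>L > 0\<close> by (simp add: field_simps)
qed

section \<open>The model minimization and the step sizes\<close>

text \<open>The Hessian of \<open>stm2_phi\<close> is the constant \<open>T\<close> times the
  identity, so completing the square at the critical point \<open>c\<close> is exact and forces
  \<open>v = c\<close>.\<close>

lemma stm2_phi_arg_min:
  fixes u y g v w :: "'a::real_inner"
  assumes "is_arg_min (stm2_phi \<mu>2 A a u y g) (\<lambda>_. True) v"
    and pos: "1 + \<mu>2 * A + \<mu>2 * a > 0"
  shows "stm2_phi \<mu>2 A a u y g w
    = stm2_phi \<mu>2 A a u y g v + (1 + \<mu>2 * A + \<mu>2 * a) / 2 * (norm (w - v))\<^sup>2"
proof -
  define T where "T = 1 + \<mu>2 * A + \<mu>2 * a"
  define c where "c = ((1 + \<mu>2 * A) *\<^sub>R u + (\<mu>2 * a) *\<^sub>R y - a *\<^sub>R g) /\<^sub>R T"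
  have "T *\<^sub>R c = (1 + \<mu>2 * A) *\<^sub>R u + (\<mu>2 * a) *\<^sub>R y - a *\<^sub>R g"
    using pos by (simp add: c_def T_def)
  hence g: "a *\<^sub>R g = (1 + \<mu>2 * A) *\<^sub>R u + (\<mu>2 * a) *\<^sub>R y - T *\<^sub>R c"
    by simp
  have square: "stm2_phi \<mu>2 A a u y g w = stm2_phi \<mu>2 A a u y g c + T / 2 * (norm (w - c))\<^sup>2" for w
  proof -
    have "a * (g \<bullet> (w - y)) = (a *\<^sub>R g) \<bullet> (w - y)" "a * (g \<bullet> (c - y)) = (a *\<^sub>R g) \<bullet> (c - y)"
      by simp_all
    thus ?thesis
      unfolding stm2_phi_def g T_def
      by (simp add: power2_norm_eq_inner inner_simps inner_commute algebra_simps
        add_divide_distrib diff_divide_distrib)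
  qed
  have "stm2_phi \<mu>2 A a u y g v \<le> stm2_phi \<mu>2 A a u y g c"
    using assms(1) by (auto simp: is_arg_min_def not_less)
  hence "T / 2 * (norm (v - c))\<^sup>2 \<le> 0"
    using square[of v] by simp
  hence "v = c"
    using pos by (simp add: T_def mult_le_0_iff)
  thus ?thesis
    using square[of w] by (simp add: T_def)
qed

text \<open>Here \<open>a = p + s\<close> is the larger root of (a - p)^2 = p^2 + 2 A p, that is, of
  a^2 = 2 p (A + a).\<close>

lemma stm2_stepsize_root:
  assumes "L > 0" "\<mu>2 \<ge> 0" "A \<ge> 0" and a: "a = stm2_stepsize L \<mu>2 A"
  shows "L * a\<^sup>2 = (1 + \<mu>2 * A) * (A + a)"
proof -
  define p s where "p = (1 + \<mu>2 * A) / (2 * L)"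
    and "s = sqrt ((1 + \<mu>2 * A)\<^sup>2 / (4 * L\<^sup>2) + A * (1 + \<mu>2 * A) / L)"
  have "s\<^sup>2 = (1 + \<mu>2 * A)\<^sup>2 / (4 * L\<^sup>2) + A * (1 + \<mu>2 * A) / L"
    unfolding s_def using assms by (intro real_sqrt_pow2) auto
  also have "\<dots> = p\<^sup>2 + 2 * A * p"
    using \<open>L > 0\<close> by (simp add: p_def power_divide power_mult_distrib)
  finally have "s\<^sup>2 = p\<^sup>2 + 2 * A * p" .
  moreover have "a = p + s"
    by (simp add: a p_def s_def stm2_stepsize_def)
  ultimately have "a\<^sup>2 = 2 * p * (A + a)"
    by (simp add: power2_eq_square algebra_simps)
  thus ?thesis
    using \<open>L > 0\<close> by (simp add: p_def)
qed

text \<open>Keeping only \<open>\<mu>2\<close> A^2 / L of the radicand suffices; this drives the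
  geometric growth of the weights \<open>A\<close>.\<close>

lemma stm2_stepsize_ge:
  assumes "L > 0" "\<mu>2 \<ge> 0" "A \<ge> 0"
  shows "sqrt (\<mu>2 / L) * A \<le> stm2_stepsize L \<mu>2 A"
proof -
  have "sqrt (\<mu>2 / L) * A = sqrt (A * (\<mu>2 * A) / L)"
    using assms by (simp add: real_sqrt_mult real_sqrt_divide)
  also have "\<dots> \<le> sqrt ((1 + \<mu>2 * A)\<^sup>2 / (4 * L\<^sup>2) + A * (1 + \<mu>2 * A) / L)"
    using assms by (intro real_sqrt_le_mono) (simp add: field_simps add_increasing)
  also have "\<dots> \<le> stm2_stepsize L \<mu>2 A"
    using assms by (simp add: stm2_stepsize_def)
  finally show ?thesis .
qed

section \<open>The potential: its change in one step and its control of the query point\<close>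

definition stm2_potential ::
  "('a::real_inner \<Rightarrow> real) \<Rightarrow> real \<Rightarrow> 'a \<Rightarrow> real \<Rightarrow> 'a \<Rightarrow> 'a \<Rightarrow> real" where
  "stm2_potential f \<mu>2 z A x u = A * (f x - f z) + (1 + \<mu>2 * A) / 2 * (norm (u - z))\<^sup>2"

text \<open>The errors made in the model of \<open>f\<close> are absorbed by the gap between \<open>L\<^sub>f\<close> and
  \<open>L = 2 L\<^sub>f\<close> on one side and between \<open>\<mu>\<close> and \<open>\<mu>\<^sub>2 = \<mu> / 2\<close> on the other.\<close>

lemma stm2_potential_step:
  fixes f :: "'a::real_inner \<Rightarrow> real"
  assumes smooth: "smooth_with (L / 2) f grad" and sc: "strongly_convex_with \<mu> f grad"
    and mu2: "\<mu>2 = \<mu> / 2" and pos: "L > 0" "\<mu> > 0" "A > 0" "a > 0"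
    and root: "L * a\<^sup>2 = (1 + \<mu>2 * A) * (A + a)"
    and y: "y = (A *\<^sub>R x + a *\<^sub>R u) /\<^sub>R (A + a)"
    and u': "is_arg_min (stm2_phi \<mu>2 A a u y g) (\<lambda>_. True) u'"
    and x': "x' = (A *\<^sub>R x + a *\<^sub>R u') /\<^sub>R (A + a)"
  shows "stm2_potential f \<mu>2 z (A + a) x' u'
    \<le> stm2_potential f \<mu>2 z A x u + (A + a) * (1 / L + 1 / \<mu>) * (norm (g - grad y))\<^sup>2"
proof -
  define B e T where "B = A + a" and "e = g - grad y" and "T = 1 + \<mu>2 * A"
  have B: "B > 0" using pos by (simp add: B_def)
  have convex: "f y + grad y \<bullet> (v - y) + \<mu> / 2 * (norm (v - y))\<^sup>2 \<le> f v" for v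
    using sc unfolding strongly_convex_with_def by (metis norm_minus_commute)
  have g: "g \<bullet> w = grad y \<bullet> w + e \<bullet> w" for w
    by (simp add: e_def inner_diff_left)
  \<comment> \<open>\<open>x'\<close> and \<open>y\<close> differ only in their \<open>u\<close>
    component, so the step size equation turns the smoothness term into the proximal term of
    \<open>stm2_phi\<close>.\<close>
  have "x' - y = (a / B) *\<^sub>R (u' - u)"
    by (simp add: x' y B_def algebra_simps divide_inverse)
  hence "(norm (x' - y))\<^sup>2 = a\<^sup>2 / B\<^sup>2 * (norm (u' - u))\<^sup>2"
    by (simp add: power_mult_distrib power_divide)
  hence "B * (L / 2 * (norm (x' - y))\<^sup>2) = L * a\<^sup>2 / (2 * B) * (norm (u' - u))\<^sup>2"
    using B by (simp add: power2_eq_square)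
  also have "\<dots> = T / 2 * (norm (u' - u))\<^sup>2"
    using B by (simp add: root[folded B_def T_def])
  finally have quad: "B * (L / 2 * (norm (x' - y))\<^sup>2) = T / 2 * (norm (u' - u))\<^sup>2" .
  have "B *\<^sub>R x' = A *\<^sub>R x + a *\<^sub>R u'"
    using B by (simp add: x' B_def)
  hence "B *\<^sub>R (x' - y) = A *\<^sub>R (x - y) + a *\<^sub>R (u' - y)"
    by (simp add: B_def algebra_simps)
  hence lin: "B * (g \<bullet> (x' - y)) = A * (g \<bullet> (x - y)) + a * (g \<bullet> (u' - y))"
    by (metis inner_add_right inner_scaleR_right)
  \<comment> \<open>Smoothness costs \<open>L / 4\<close>; Young's inequality uses the other
    \<open>L / 4\<close> to absorb \<open>e\<close>.\<close>
  have "f x' \<le> f y + g \<bullet> (x' - y) + L / 2 * (norm (x' - y))\<^sup>2 + (norm e)\<^sup>2 / L"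
    using smooth_with_descent[OF smooth, of x' y] young_inner[of "L / 4" "- e" "x' - y"] \<open>L > 0\<close>
    by (simp add: g)
  hence "B * f x' \<le> B * (f y + g \<bullet> (x' - y) + L / 2 * (norm (x' - y))\<^sup>2 + (norm e)\<^sup>2 / L)"
    using B by (intro mult_left_mono) auto
  also have "\<dots> = A * (f y + g \<bullet> (x - y)) + a * (f y + g \<bullet> (u' - y))
      + T / 2 * (norm (u' - u))\<^sup>2 + B * (norm e)\<^sup>2 / L"
    using quad lin by (simp add: B_def algebra_simps)
  finally have upper: "B * f x' \<le> A * (f y + g \<bullet> (x - y)) + a * (f y + g \<bullet> (u' - y))
      + T / 2 * (norm (u' - u))\<^sup>2 + B * (norm e)\<^sup>2 / L" .
  \<comment> \<open>Half of the curvature \<open>\<mu> / 2\<close> absorbs \<open>e\<close>; the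
    remaining \<open>\<mu> / 4\<close> is exactly the weight \<open>\<mu>2 / 2\<close> in
    \<open>stm2_phi\<close>.\<close>
  have model: "f y + g \<bullet> (v - y) + \<mu> / 4 * (norm (v - y))\<^sup>2 \<le> f v + (norm e)\<^sup>2 / \<mu>" for v
    using convex[of v] young_inner[of "\<mu> / 4" e "v - y"] \<open>\<mu> > 0\<close> by (simp add: g)
  have "f y + g \<bullet> (x - y) \<le> f x + (norm e)\<^sup>2 / \<mu>"
    using model[of x] \<open>\<mu> > 0\<close> by (smt (verit) mult_nonneg_nonneg divide_nonneg_nonneg zero_le_power2)
  hence low_x: "A * (f y + g \<bullet> (x - y)) \<le> A * (f x + (norm e)\<^sup>2 / \<mu>)"
    using \<open>A > 0\<close> by (intro mult_left_mono) auto
  have low_z: "a * (f y + g \<bullet> (z - y) + \<mu> / 4 * (norm (z - y))\<^sup>2) \<le> a * (f z + (norm e)\<^sup>2 / \<mu>)"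
    using model[of z] \<open>a > 0\<close> by (intro mult_left_mono) auto
  have "1 + \<mu>2 * A + \<mu>2 * a > 0"
    using pos by (simp add: mu2 add_pos_pos)
  from stm2_phi_arg_min[OF u' this, of z]
  have "a * (g \<bullet> (u' - y)) + T / 2 * (norm (u' - u))\<^sup>2 + \<mu>2 * a / 2 * (norm (y - u'))\<^sup>2
      + (1 + \<mu>2 * B) / 2 * (norm (u' - z))\<^sup>2
    = a * (g \<bullet> (z - y)) + T / 2 * (norm (u - z))\<^sup>2 + a * (\<mu> / 4 * (norm (z - y))\<^sup>2)"
    by (simp add: stm2_phi_def T_def B_def mu2 norm_minus_commute algebra_simps)
  moreover have "\<mu>2 * a / 2 * (norm (y - u'))\<^sup>2 \<ge> 0"
    using pos by (simp add: mu2)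
  moreover have "A * ((norm e)\<^sup>2 / \<mu>) + a * ((norm e)\<^sup>2 / \<mu>) + B * (norm e)\<^sup>2 / L
      = B * (1 / L + 1 / \<mu>) * (norm e)\<^sup>2"
    by (simp add: B_def algebra_simps add_divide_distrib)
  ultimately have "B * f x' + (1 + \<mu>2 * B) / 2 * (norm (u' - z))\<^sup>2
      \<le> A * f x + a * f z + T / 2 * (norm (u - z))\<^sup>2 + B * (1 / L + 1 / \<mu>) * (norm e)\<^sup>2"
    using upper low_x low_z unfolding distrib_left by linarith
  thus ?thesis
    unfolding stm2_potential_def B_def[symmetric] T_def[symmetric] e_def[symmetric]
    unfolding right_diff_distrib by (simp add: B_def distrib_right)
qed

text \<open>Convexity splits the gap at \<open>y\<close> over \<open>x\<close> and \<open>u\<close>.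
  Relative to the potential these parts carry the factors 1 / (A + a) and 1 / (2 a), and
  \<open>c\<close> dominates both.\<close>

lemma stm2_query_gap:
  fixes f :: "'a::real_inner \<Rightarrow> real"
  assumes smooth: "smooth_with (L / 2) f grad" and sc: "strongly_convex_with \<mu> f grad"
    and pos: "L > 0" "\<mu> > 0" "\<mu>2 > 0" "A > 0" "a > 0"
    and min: "\<And>v. f z \<le> f v"
    and root: "L * a\<^sup>2 = (1 + \<mu>2 * A) * (A + a)"
    and y: "y = (A *\<^sub>R x + a *\<^sub>R u) /\<^sub>R (A + a)"
    and c: "1 \<le> c * (A + a)" "1 \<le> c * (2 * a)"
  shows "f y - f z \<le> c * stm2_potential f \<mu>2 z A x u"
proof -
  define B T where "B = A + a" and "T = 1 + \<mu>2 * A"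
  have B: "B > 0" and T: "T > 0" using pos by (simp_all add: B_def T_def add_pos_pos)
  have convex: "f y + grad y \<bullet> (v - y) \<le> f v" for v
    using sc \<open>\<mu> > 0\<close> by (smt (verit, best) strongly_convex_with_def divide_pos_pos
        mult_nonneg_nonneg zero_le_power2)
  have "B *\<^sub>R y = A *\<^sub>R x + a *\<^sub>R u"
    using B by (simp add: y B_def)
  hence "A *\<^sub>R (x - y) + a *\<^sub>R (u - y) = 0"
    by (simp add: B_def algebra_simps)
  hence "A * (grad y \<bullet> (x - y)) + a * (grad y \<bullet> (u - y)) = 0"
    by (metis inner_add_right inner_scaleR_right inner_zero_right)
  hence "B * f y = A * (f y + grad y \<bullet> (x - y)) + a * (f y + grad y \<bullet> (u - y))"
    by (simp add: B_def algebra_simps)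
  also have "\<dots> \<le> A * f x + a * f u"
    using convex pos by (intro add_mono mult_left_mono) auto
  finally have gap: "B * (f y - f z) \<le> A * (f x - f z) + a * (f u - f z)"
    by (simp add: B_def algebra_simps)
  \<comment> \<open>With \<open>f z\<close> as the lower bound, the gradient estimate at
    \<open>z\<close> itself has right-hand side 0.\<close>
  have "(norm (grad z))\<^sup>2 \<le> 2 * (L / 2) * (f z - f z)"
    using smooth _ min by (rule smooth_with_norm_grad_le) (use \<open>L > 0\<close> in simp)
  hence "grad z = 0" by simp
  hence "f u - f z \<le> L / 4 * (norm (u - z))\<^sup>2"
    using smooth_with_descent[OF smooth, of u z] by simp
  hence "a * (f u - f z) \<le> a * (L / 4 * (norm (u - z))\<^sup>2)"
    using \<open>a > 0\<close> by (intro mult_left_mono) auto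
  also have "\<dots> = B / (2 * a) * (T / 2 * (norm (u - z))\<^sup>2)"
    using root[folded B_def T_def] \<open>a > 0\<close> by (simp add: field_simps power2_eq_square)
  also have "\<dots> \<le> c * B * (T / 2 * (norm (u - z))\<^sup>2)"
    using c(2) \<open>a > 0\<close> B T by (intro mult_right_mono) (auto simp: field_simps)
  finally have u: "a * (f u - f z) \<le> c * B * (T / 2 * (norm (u - z))\<^sup>2)" .
  have "A * (f x - f z) * 1 \<le> A * (f x - f z) * (c * B)"
    using min[of x] \<open>A > 0\<close> c(1) by (intro mult_left_mono) (auto simp: B_def)
  with gap u have "B * (f y - f z) \<le> A * (f x - f z) * (c * B) + c * B * (T / 2 * (norm (u - z))\<^sup>2)"
    by linarith
  also have "\<dots> = B * (c * stm2_potential f \<mu>2 z A x u)"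
    unfolding stm2_potential_def T_def[symmetric] by (simp add: algebra_simps)
  finally have "B * (f y - f z) \<le> B * (c * stm2_potential f \<mu>2 z A x u)" .
  thus ?thesis using B by simp
qed

section \<open>The condition number and an exponential estimate\<close>

text \<open>The upper and lower quadratic bounds are compared at some nonzero \<open>v\<close>,
  which \<open>perfect_space\<close> provides. The theorem gets \<open>t \<le> 1 / 2\<close> from
  this.\<close>

lemma strong_convexity_le_smoothness:
  fixes f :: "'a::{real_inner,perfect_space} \<Rightarrow> real"
  assumes smooth: "smooth_with L f grad" and sc: "strongly_convex_with \<mu> f grad"
  shows "\<mu> \<le> L"
proof -
  obtain v :: 'a where v: "v \<noteq> 0"
    using UNIV_not_singleton[of "0::'a"] by auto
  have "\<mu> / 2 * (norm v)\<^sup>2 \<le> L / 2 * (norm v)\<^sup>2"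
    using smooth_with_descent[OF smooth, of v 0] sc
    by (smt (verit) strongly_convex_with_def diff_zero diff_0 norm_minus_cancel)
  thus ?thesis using v by simp
qed

text \<open>Inverts the tangent bound at -3 t / 5, since (1 + t) (1 - 3 t / 5) = 1 + t (2 - 3 t) /
  5.\<close>

lemma exp_le_one_plus:
  fixes t :: real
  assumes "0 \<le> t" "t \<le> 1 / 2"
  shows "exp (3 * t / 5) \<le> 1 + t"
proof -
  have "1 \<le> (1 + t) * (1 - 3 * t / 5)"
    using assms mult_nonneg_nonneg[of t "2 - 3 * t"] by (simp add: algebra_simps)
  also have "\<dots> \<le> (1 + t) * exp (- (3 * t / 5))"
    using assms exp_ge_add_one_self[of "- (3 * t / 5)"] by (intro mult_left_mono) auto
  finally show ?thesis by (simp add: exp_minus field_simps)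
qed

section \<open>Growth of the weights against growth of the potential\<close>

theorem theorem5p1:
  fixes f :: "real ^ 'n \<Rightarrow> real"
    and grad G :: "real ^ 'n \<Rightarrow> real ^ 'n"
    and x_start x_star :: "real ^ 'n"
    and L_f L \<mu> \<mu>2 \<alpha> R :: real
    and a A :: "nat \<Rightarrow> real"
    and x y u :: "nat \<Rightarrow> real ^ 'n"
  assumes smooth: "smooth_with L_f f grad"
    and strongly_convex: "strongly_convex_with \<mu> f grad"
    and mu_pos: "\<mu> > 0"
    and minimizer: "is_arg_min f (\<lambda>_. True) x_star"
    and inexact: "\<And>z. norm (G z - grad z) \<le> \<alpha> * norm (grad z)"
    and alpha_range: "0 \<le> \<alpha>" "\<alpha> < 1"
    and mu2: "\<mu>2 = \<mu> / 2"
    and L: "L = 2 * L_f"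
    and alpha_le: "\<alpha> \<le> 1 / 7 * (\<mu>2 / L)"
    and radius: "norm (x_start - x_star) \<le> R"
    and run: "stm2_run L \<mu>2 x_start G a A x y u"
  shows "\<forall>k\<ge>1. f (y k) - f x_star
      \<le> (5 * L * R\<^sup>2 / 4 + 15 / 196 * sqrt (2 * L / \<mu>) * (f (y 0) - f x_star))
          * exp (- (real k / 4) * sqrt (\<mu> / (2 * L)))"
proof -
  define t where "t = sqrt (\<mu>2 / L)"
  define P where "P k = stm2_potential f \<mu>2 x_star (A k) (x k) (u k)" for k
  have "\<mu> \<le> L_f"
    using smooth strongly_convex by (rule strong_convexity_le_smoothness)
  hence pos: "L > 0" "\<mu>2 > 0" "4 * \<mu>2 \<le> L"
    using mu_pos by (simp_all add: L mu2)
  have t2: "t\<^sup>2 = \<mu>2 / L"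
    using pos by (simp add: t_def)
  have alpha: "\<alpha> \<le> t\<^sup>2 / 7"
    using alpha_le by (simp add: t2)
  have t: "t > 0" "t \<le> 1 / 2"
  proof -
    show "t > 0" using pos by (simp add: t_def)
    have "t\<^sup>2 \<le> 1 / 4" unfolding t2 using pos by (simp add: field_simps)
    hence "t\<^sup>2 \<le> (1 / 2)\<^sup>2" by (simp add: power_divide)
    thus "t \<le> 1 / 2" by (rule power2_le_imp_le) simp
  qed
  have smooth': "smooth_with (L / 2) f grad" using smooth L by simp
  have min: "f x_star \<le> f v" for v
    using minimizer by (auto simp: is_arg_min_def not_less)
  have init: "u 0 = x_start" "x 0 = x_start" "A 0 = 1 / L"
    using run by (auto simp: stm2_run_def)
  have step: "a (Suc k) = stm2_stepsize L \<mu>2 (A k)" "A (Suc k) = A k + a (Suc k)"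
    "y (Suc k) = (A k *\<^sub>R x k + a (Suc k) *\<^sub>R u k) /\<^sub>R (A k + a (Suc k))"
    "is_arg_min (stm2_phi \<mu>2 (A k) (a (Suc k)) (u k) (y (Suc k)) (G (y (Suc k))))
       (\<lambda>_. True) (u (Suc k))"
    "x (Suc k) = (A k *\<^sub>R x k + a (Suc k) *\<^sub>R u (Suc k)) /\<^sub>R (A k + a (Suc k))" for k
    using run[unfolded stm2_run_def, THEN conjunct2, THEN conjunct2, THEN conjunct2,
      THEN conjunct2, THEN conjunct2, rule_format, of "Suc k"] by auto
  have A_ge: "A k > 0 \<and> A k \<ge> exp (3 * t / 5 * k) / L" for k
  proof (induction k)
    case 0 thus ?case using pos by (simp add: init)
  next
    case (Suc k)
    have "t * A k \<le> a (Suc k)"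
      using stm2_stepsize_ge[of L \<mu>2 "A k"] pos Suc by (simp add: t_def step(1))
    hence le: "(1 + t) * A k \<le> A (Suc k)"
      by (simp add: step(2) algebra_simps)
    have "exp (3 * t / 5 * Suc k) / L = exp (3 * t / 5) * (exp (3 * t / 5 * k) / L)"
      by (simp add: exp_add[symmetric] algebra_simps)
    also have "\<dots> \<le> (1 + t) * A k"
      using Suc exp_le_one_plus[of t] t pos by (intro mult_mono) auto
    finally have "exp (3 * t / 5 * Suc k) / L \<le> (1 + t) * A k" .
    moreover have "0 < (1 + t) * A k" using Suc t by simp
    ultimately show ?case using le by linarith
  qed
  hence A_pos: "A k > 0" for k by blast
  have a_ge: "t * A k \<le> a (Suc k)" for k
    using stm2_stepsize_ge[of L \<mu>2 "A k"] pos A_pos[of k] by (simp add: t_def step(1))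
  hence a_pos: "a (Suc k) > 0" for k
    using t A_pos[of k] by (smt (verit) mult_pos_pos)
  have root: "L * (a (Suc k))\<^sup>2 = (1 + \<mu>2 * A k) * (A k + a (Suc k))" for k
    using pos A_pos[of k] by (intro stm2_stepsize_root step) auto
  have gap: "f (y (Suc k)) - f x_star \<le> c * P k"
    if "1 \<le> c * A (Suc k)" "1 \<le> c * (2 * a (Suc k))" for c k
    unfolding P_def
    by (rule stm2_query_gap[OF smooth' strongly_convex pos(1) mu_pos pos(2) A_pos a_pos min root
      step(3)]) (use that in \<open>simp_all add: step(2)\<close>)
  have P_nonneg: "P k \<ge> 0" for k
    unfolding P_def stm2_potential_def
    using min[of "x k"] A_pos[of k] pos by (intro add_nonneg_nonneg mult_nonneg_nonneg) auto
  have P_step: "P (Suc k) \<le> (1 + t / 80) * P k" for k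
  proof -
    define B D where "B = A (Suc k)" and "D = f (y (Suc k)) - f x_star"
    have B: "B > 0" "B = A k + a (Suc k)" using A_pos[of "Suc k"] by (simp_all add: B_def step(2))
    \<comment> \<open>Adds 2 t A \<le> 2 a and 2 t a \<le> a. Hence 3 / (4 t B) is an admissible
      factor in \<open>gap\<close>.\<close>
    have ta: "2 * t * B \<le> 3 * a (Suc k)"
    proof -
      have "2 * t * a (Suc k) \<le> 1 * a (Suc k)"
        using t a_pos[of k] by (intro mult_right_mono) auto
      thus ?thesis using a_ge[of k] by (simp add: B(2) algebra_simps)
    qed
    have "D \<le> 3 / (4 * t * B) * P k"
    proof (unfold D_def, rule gap)
      show "1 \<le> 3 / (4 * t * B) * A (Suc k)"
        using t B(1) by (simp add: B_def[symmetric] field_simps)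
      show "1 \<le> 3 / (4 * t * B) * (2 * a (Suc k))"
        using ta t B(1) by (simp add: field_simps)
    qed
    hence BD: "B * D \<le> 3 / (4 * t) * P k"
      using B(1) t by (simp add: field_simps)
    have "norm (G (y (Suc k)) - grad (y (Suc k))) \<le> t\<^sup>2 / 7 * norm (grad (y (Suc k)))"
      by (rule order_trans[OF inexact mult_right_mono[OF alpha norm_ge_zero]])
    hence "(norm (G (y (Suc k)) - grad (y (Suc k))))\<^sup>2
        \<le> (t\<^sup>2 / 7 * norm (grad (y (Suc k))))\<^sup>2"
      by (intro power_mono) auto
    also have "\<dots> = (t\<^sup>2 / 7)\<^sup>2 * (norm (grad (y (Suc k))))\<^sup>2"
      by (rule power_mult_distrib)
    also have "\<dots> \<le> (t\<^sup>2 / 7)\<^sup>2 * (L * D)"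
      using smooth_with_norm_grad_le[OF smooth' _ min, of "y (Suc k)"] pos
      by (intro mult_left_mono) (auto simp: D_def)
    finally have noise: "(norm (G (y (Suc k)) - grad (y (Suc k))))\<^sup>2 \<le> (t\<^sup>2 / 7)\<^sup>2 * (L * D)" .
    have "P (Suc k) \<le> P k + B * (1 / L + 1 / \<mu>) * (norm (G (y (Suc k)) - grad (y (Suc k))))\<^sup>2"
      using stm2_potential_step[OF smooth' strongly_convex mu2 pos(1) mu_pos A_pos a_pos root
        step(3-5)]
      unfolding P_def B(2) step(2) .
    also have "\<dots> \<le> P k + B * (1 / L + 1 / \<mu>) * ((t\<^sup>2 / 7)\<^sup>2 * (L * D))"
      using noise B pos mu_pos by (intro add_left_mono mult_left_mono) auto
    also have "\<dots> = P k + (1 + L / \<mu>) * (t\<^sup>2 / 7)\<^sup>2 * (B * D)"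
      using pos by (simp add: field_simps)
    \<comment> \<open>The powers of \<open>t\<close> combine to t^4 / t^3, leaving 9 t / 784, which
      is below t / 80.\<close>
    also have "\<dots> \<le> P k + 3 / (4 * t\<^sup>2) * (t\<^sup>2 / 7)\<^sup>2 * (3 / (4 * t) * P k)"
    proof (intro add_left_mono mult_mono[OF mult_right_mono BD])
      have "L / \<mu> = 1 / (2 * t\<^sup>2)" using pos by (simp add: t2 mu2)
      moreover have "1 \<le> 1 / (4 * t\<^sup>2)" using pos by (simp add: t2)
      ultimately show "1 + L / \<mu> \<le> 3 / (4 * t\<^sup>2)" by simp
    qed (use B(1) min[of "y (Suc k)"] in \<open>auto simp: D_def\<close>)
    also have "\<dots> = P k + 9 / 784 * t * P k"
      using t by (simp add: field_simps power2_eq_square)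
    also have "\<dots> \<le> (1 + t / 80) * P k"
      using P_nonneg[of k] t by (simp add: algebra_simps)
    finally show ?thesis .
  qed
  have norm0: "(norm (x_start - x_star))\<^sup>2 \<le> R\<^sup>2"
    using radius by (intro power_mono) auto
  \<comment> \<open>7/8 is 1/4 from smoothness at the minimizer plus 5/8 from
    \<open>4 * \<mu>2 \<le> L\<close>.\<close>
  have P0: "P 0 \<le> 7 / 8 * R\<^sup>2"
  proof -
    have "(norm (grad x_star))\<^sup>2 \<le> 2 * (L / 2) * (f x_star - f x_star)"
      using smooth' _ min by (rule smooth_with_norm_grad_le) (use pos in simp)
    hence "f x_start - f x_star \<le> L / 4 * (norm (x_start - x_star))\<^sup>2"
      using smooth_with_descent[OF smooth', of x_start x_star] by simp
    hence "1 / L * (f x_start - f x_star) \<le> 1 / 4 * (norm (x_start - x_star))\<^sup>2"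
      using pos by (simp add: field_simps)
    moreover have "(1 + \<mu>2 / L) / 2 * (norm (x_start - x_star))\<^sup>2
        \<le> 5 / 8 * (norm (x_start - x_star))\<^sup>2"
      using pos by (intro mult_right_mono) (auto simp: field_simps)
    moreover have "P 0 = 1 / L * (f x_start - f x_star) + (1 + \<mu>2 / L) / 2 * (norm (x_start - x_star))\<^sup>2"
      by (simp add: P_def stm2_potential_def init)
    ultimately show ?thesis
      using norm0 by linarith
  qed
  have P_le: "P k \<le> exp (t / 80 * k) * (7 / 8 * R\<^sup>2)" for k
  proof (induction k)
    case 0 thus ?case using P0 by simp
  next
    case (Suc k)
    have "P (Suc k) \<le> (1 + t / 80) * P k" by (rule P_step)
    also have "\<dots> \<le> exp (t / 80) * (exp (t / 80 * k) * (7 / 8 * R\<^sup>2))"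
      using Suc P_nonneg[of k] exp_ge_add_one_self[of "t / 80"] by (intro mult_mono) auto
    also have "\<dots> = exp (t / 80 * Suc k) * (7 / 8 * R\<^sup>2)"
      by (simp add: exp_add[symmetric] algebra_simps)
    finally show ?case .
  qed
  have main: "f (y (Suc k)) - f x_star \<le> 5 * L * R\<^sup>2 / 4 * exp (- (real (Suc k) / 4) * t)" for k
  proof -
    \<comment> \<open>\<open>E\<close> is the square root of the lower bound for
      \<open>L * A (Suc k)\<close>, as the step size equation controls only the square of
      \<open>L * a (Suc k)\<close>. Then \<open>L / E\<close> is admissible in
      \<open>gap\<close>.\<close>
    define E where "E = exp (3 * t / 10 * Suc k)"
    have E: "E \<ge> 1" "E\<^sup>2 = exp (3 * t / 5 * Suc k)"
      using t by (simp_all add: E_def power2_eq_square exp_add[symmetric])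
    have "E\<^sup>2 \<le> L * A (Suc k)"
      using A_ge[of "Suc k"] pos by (simp add: E field_simps)
    also have "\<dots> \<le> (1 + \<mu>2 * A k) * (L * A (Suc k))"
      using pos A_pos[of k] A_pos[of "Suc k"] by (simp add: distrib_right)
    also have "\<dots> = (L * a (Suc k))\<^sup>2"
      using root[of k] by (simp add: step(2) power2_eq_square algebra_simps)
    finally have "E \<le> L * a (Suc k)"
      by (rule power2_le_imp_le) (use pos a_pos[of k] in auto)
    moreover have "L * a (Suc k) \<le> L * A (Suc k)"
      using pos A_pos[of k] by (simp add: step(2))
    ultimately have "f (y (Suc k)) - f x_star \<le> L / E * P k"
      by (intro gap) (use E(1) in \<open>auto simp: field_simps\<close>)
    also have "\<dots> \<le> L / E * (exp (t / 80 * k) * (7 / 8 * R\<^sup>2))"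
      using pos E P_le by (intro mult_left_mono) auto
    also have "\<dots> = 7 / 8 * L * R\<^sup>2 * exp (t / 80 * k - 3 * t / 10 * Suc k)"
      by (simp add: E_def exp_diff mult_ac)
    also have "\<dots> \<le> 5 / 4 * L * R\<^sup>2 * exp (- (real (Suc k) / 4) * t)"
    proof (rule mult_mono)
      \<comment> \<open>The net rate 3/10 - 1/80 exceeds 1/4 by 3/80; the extra t / 20 arises
        because the potential is taken at \<open>k\<close> and \<open>E\<close> at
        \<open>Suc k\<close>.\<close>
      have "- (real (Suc k) / 4) * t - (t / 80 * k - 3 * t / 10 * Suc k) = 3 / 80 * (t * k) + t / 20"
        by (simp add: field_simps)
      moreover have "0 \<le> 3 / 80 * (t * k) + t / 20" using t by simp
      ultimately have "t / 80 * k - 3 * t / 10 * Suc k \<le> - (real (Suc k) / 4) * t"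
        by linarith
      thus "exp (t / 80 * k - 3 * t / 10 * Suc k) \<le> exp (- (real (Suc k) / 4) * t)"
        by (rule exp_mono)
    qed (use pos in auto)
    finally show ?thesis by simp
  qed
  show ?thesis
  proof (intro allI impI)
    fix k :: nat assume "k \<ge> 1"
    then obtain j where j: "k = Suc j" by (cases k) auto
    have "\<mu> / (2 * L) = \<mu>2 / L" by (simp add: mu2)
    hence t_eq: "sqrt (\<mu> / (2 * L)) = t" by (simp add: t_def)
    \<comment> \<open>Nonnegativity of the second summand carries the bound \<open>main\<close> over
      to the stated one.\<close>
    have "0 \<le> 15 / 196 * sqrt (2 * L / \<mu>) * (f (y 0) - f x_star)"
      using pos mu_pos min by (intro mult_nonneg_nonneg) auto
    hence "5 * L * R\<^sup>2 / 4 * exp (- (real k / 4) * t)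
        \<le> (5 * L * R\<^sup>2 / 4 + 15 / 196 * sqrt (2 * L / \<mu>) * (f (y 0) - f x_star))
          * exp (- (real k / 4) * t)"
      by (intro mult_right_mono) auto
    thus "f (y k) - f x_star
      \<le> (5 * L * R\<^sup>2 / 4 + 15 / 196 * sqrt (2 * L / \<mu>) * (f (y 0) - f x_star))
          * exp (- (real k / 4) * sqrt (\<mu> / (2 * L)))"
      using main[of j] unfolding t_eq j by linarith
  qed
qed

end
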